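(* Let $\Omega$ be a finite set, let $f:2^{\Omega}\to\mathbb{R}$ be a monotone, normalized submodular function, and let $A,B\subseteq\Omega$ be disjoint. Let $JI, MI, PI, SMI, ModI, SModI$ denote the six independence relations between $A$ and $B$ with respect to $f$ defined in the context. Then $$ModI \implies JI \implies MI \iff SMI \implies PI \quad\text{and}\quad ModI \implies SModI \implies MI .$$ Moreover, none of the following implications holds in general: $JI \Rightarrow ModI$, $SModI \Rightarrow ModI$, $JI \Rightarrow SModI$, $SModI \Rightarrow JI$, $MI \Rightarrow SModI$, $MI \Rightarrow JI$, $PI \Rightarrow MI$. That is, for each implication $P\Rightarrow Q$ in this list there exist a finite set $\Omega$, a monotone, normalized submodular function $f:2^{\Omega}\to\mathbb{R}$, and disjoint $A,B\subseteq\Omega$ such that $P$ holds and $Q$ fails for $A,B$ with respect to $f$.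
   Context: A set function $f:2^{\Omega}\to\mathbb{R}$ is submodular if $f(S)+f(T)\ge f(S\cup T)+f(S\cap T)$ for all $S,T\subseteq\Omega$; monotone if $f(S)\le f(T)$ whenever $S\subseteq T$; normalized if $f(\emptyset)=0$. For $S,T\subseteq\Omega$ write $f(S|T)=f(S\cup T)-f(T)$, and $I_f(S;T)=f(S)+f(T)-f(S\cup T)$. For disjoint $A,B\subseteq\Omega$, the independence relations with respect to $f$ are: 1. $JI$ (joint independence): $I_f(A;B)=0$, equivalently $f(A|B)=f(A)$. 2. $MI$ (marginal independence): $f(\{a\}|B)=f(\{a\})$ for all $a\in A$, and $f(\{b\}|A)=f(\{b\})$ for all $b\in B$. 3. $PI$ (pairwise independence): $f(\{a\}|\{b\})=f(\{a\})$ and $f(\{b\}|\{a\})=f(\{b\})$ for all $a\in A$, $b\in B$. 4. $SMI$ (subset marginal independence): $f(\{a\}|X)=f(\{a\})$ for all $a\in A$, $X\subseteq B$, and $f(\{b\}|X)=f(\{b\})$ for all $b\in B$, $X\subseteq A$. 5. $ModI$ (modular independence): $f(\{j\}|X)=f(\{j\})$ for all $X\subseteq A\cup B$ and all $j\in (A\cup B)\setminus X$. 6. $SModI$ (subset modular independence): $f(\{j\}|X)=f(\{j\})$ for all $X$ with $X\subseteq A$ or $X\subseteq B$, and all $j\in (A\cup B)\setminus X$. *)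

theory Defs
  imports Complex_Main
begin

text \<open>A set function on the subsets of \<open>\<Omega>\<close> is a function on \<open>'a set\<close>, of which only the values on
  \<open>Pow \<Omega>\<close> matter; monotonicity on \<open>Pow \<Omega>\<close> is \<open>mono_on (Pow \<Omega>) f\<close>.\<close>

definition submodular_on :: "'a set \<Rightarrow> ('a set \<Rightarrow> real) \<Rightarrow> bool" where
  "submodular_on \<Omega> f \<longleftrightarrow>
     (\<forall>S T. S \<subseteq> \<Omega> \<and> T \<subseteq> \<Omega> \<longrightarrow> f S + f T \<ge> f (S \<union> T) + f (S \<inter> T))"

definition normalized :: "('a set \<Rightarrow> real) \<Rightarrow> bool" where
  "normalized f \<longleftrightarrow> f {} = 0"

text \<open>\<open>marginal f S T\<close> is $f(S|T)$, and \<open>mutual_info f S T\<close> is $I_f(S;T)$.\<close>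

definition marginal :: "('a set \<Rightarrow> real) \<Rightarrow> 'a set \<Rightarrow> 'a set \<Rightarrow> real" where
  "marginal f S T = f (S \<union> T) - f T"

definition mutual_info :: "('a set \<Rightarrow> real) \<Rightarrow> 'a set \<Rightarrow> 'a set \<Rightarrow> real" where
  "mutual_info f S T = f S + f T - f (S \<union> T)"

text \<open>The independence relations below are meant for disjoint \<open>A\<close> and \<open>B\<close>.\<close>

definition JI :: "('a set \<Rightarrow> real) \<Rightarrow> 'a set \<Rightarrow> 'a set \<Rightarrow> bool" where
  "JI f A B \<longleftrightarrow> mutual_info f A B = 0"

definition MI :: "('a set \<Rightarrow> real) \<Rightarrow> 'a set \<Rightarrow> 'a set \<Rightarrow> bool" where
  "MI f A B \<longleftrightarrow>
     (\<forall>a\<in>A. marginal f {a} B = f {a}) \<and>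
     (\<forall>b\<in>B. marginal f {b} A = f {b})"

definition PI :: "('a set \<Rightarrow> real) \<Rightarrow> 'a set \<Rightarrow> 'a set \<Rightarrow> bool" where
  "PI f A B \<longleftrightarrow>
     (\<forall>a\<in>A. \<forall>b\<in>B. marginal f {a} {b} = f {a} \<and> marginal f {b} {a} = f {b})"

definition SMI :: "('a set \<Rightarrow> real) \<Rightarrow> 'a set \<Rightarrow> 'a set \<Rightarrow> bool" where
  "SMI f A B \<longleftrightarrow>
     (\<forall>a\<in>A. \<forall>X. X \<subseteq> B \<longrightarrow> marginal f {a} X = f {a}) \<and>
     (\<forall>b\<in>B. \<forall>X. X \<subseteq> A \<longrightarrow> marginal f {b} X = f {b})"

definition ModI :: "('a set \<Rightarrow> real) \<Rightarrow> 'a set \<Rightarrow> 'a set \<Rightarrow> bool" where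
  "ModI f A B \<longleftrightarrow>
     (\<forall>X. X \<subseteq> A \<union> B \<longrightarrow> (\<forall>j \<in> (A \<union> B) - X. marginal f {j} X = f {j}))"

definition SModI :: "('a set \<Rightarrow> real) \<Rightarrow> 'a set \<Rightarrow> 'a set \<Rightarrow> bool" where
  "SModI f A B \<longleftrightarrow>
     (\<forall>X. X \<subseteq> A \<or> X \<subseteq> B \<longrightarrow> (\<forall>j \<in> (A \<union> B) - X. marginal f {j} X = f {j}))"

end

(* The positive part rests on diminishing returns: f(a|Y) \<le> f(a|X) \<le> f(a) for X \<subseteq> Y not containing a,
   so that independence from a set passes to all its subsets; and ModI makes f additive on singletons.
   All counterexamples are rank functions of matroids: truncations of free matroids, and
   a free matroid with an element doubled. *)
theory Submission imports Defs begin

lemma submodular_onD: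
  assumes "submodular_on \<Omega> f" "S \<subseteq> \<Omega>" "T \<subseteq> \<Omega>"
  shows "f (S \<union> T) + f (S \<inter> T) \<le> f S + f T"
  using assms by (auto simp: submodular_on_def)

lemma marginal_le:
  assumes "submodular_on \<Omega> f" "normalized f" "S \<subseteq> \<Omega>" "T \<subseteq> \<Omega>" "S \<inter> T = {}"
  shows "marginal f S T \<le> f S"
  using submodular_onD[OF assms(1,3,4)] assms(2,5) by (simp add: marginal_def normalized_def)

text \<open>Submodularity for \<open>S \<union> X\<close> and \<open>Y\<close>: their union is
  \<open>S \<union> Y\<close>, and their intersection is \<open>X\<close> because \<open>S\<close>
  misses \<open>Y\<close>.\<close>

lemma marginal_antimono:
  assumes "submodular_on \<Omega> f" "S \<subseteq> \<Omega>" "Y \<subseteq> \<Omega>" "X \<subseteq> Y" "S \<inter> Y = {}"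
  shows "marginal f S Y \<le> marginal f S X"
proof -
  have "(S \<union> X) \<union> Y = S \<union> Y" "(S \<union> X) \<inter> Y = X"
    using assms(4,5) by auto
  moreover have "S \<union> X \<subseteq> \<Omega>"
    using assms(2-4) by auto
  ultimately show ?thesis
    using submodular_onD[OF assms(1), of "S \<union> X" Y] assms(3) by (simp add: marginal_def)
qed

text \<open>A squeeze: f(S) = f(S|Y) \<le> f(S|X) \<le> f(S).\<close>

lemma marginal_eq_subset:
  assumes "submodular_on \<Omega> f" "normalized f" "S \<subseteq> \<Omega>" "Y \<subseteq> \<Omega>" "X \<subseteq> Y" "S \<inter> Y = {}"
    and "marginal f S Y = f S"
  shows "marginal f S X = f S"
  using marginal_antimono[OF assms(1,3-6)] marginal_le[OF assms(1-3), of X] assms(4-7) by force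

lemma mutual_info_commute: "mutual_info f A B = mutual_info f B A"
  by (simp add: mutual_info_def Un_commute)

text \<open>Submodularity for \<open>{a} \<union> B\<close> and \<open>A\<close> gives f(A \<union>
  B) + f(a) \<le> f({a} \<union> B) + f(A). Substituting f(A \<union> B) = f(A) + f(B) cancels f(A)
  and leaves the lower bound on the marginal.\<close>

lemma marginal_singleton_if_mutual_info_zero:
  assumes "submodular_on \<Omega> f" "normalized f" "A \<subseteq> \<Omega>" "B \<subseteq> \<Omega>" "A \<inter> B = {}"
    and "mutual_info f A B = 0" "a \<in> A"
  shows "marginal f {a} B = f {a}"
proof (rule antisym)
  show "marginal f {a} B \<le> f {a}"
    using assms by (intro marginal_le) auto
  have "({a} \<union> B) \<union> A = A \<union> B" "({a} \<union> B) \<inter> A = {a}"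
    using assms(5,7) by auto
  moreover have "{a} \<union> B \<subseteq> \<Omega>"
    using assms(3,4,7) by auto
  ultimately show "f {a} \<le> marginal f {a} B"
    using submodular_onD[OF assms(1), of "{a} \<union> B" A] assms(3,6)
    unfolding marginal_def mutual_info_def by simp
qed

lemma JI_imp_MI:
  assumes "submodular_on \<Omega> f" "normalized f" "A \<subseteq> \<Omega>" "B \<subseteq> \<Omega>" "A \<inter> B = {}" "JI f A B"
  shows "MI f A B"
  using marginal_singleton_if_mutual_info_zero[OF assms(1,2,3,4)]
    marginal_singleton_if_mutual_info_zero[OF assms(1,2,4,3)] assms(5,6)
  by (auto simp: MI_def JI_def mutual_info_commute[of f B A] Int_commute)

lemma MI_iff_SMI:
  assumes "submodular_on \<Omega> f" "normalized f" "A \<subseteq> \<Omega>" "B \<subseteq> \<Omega>" "A \<inter> B = {}"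
  shows "MI f A B \<longleftrightarrow> SMI f A B"
proof
  assume MI: "MI f A B"
  have "marginal f {a} X = f {a}" if "a \<in> A" "X \<subseteq> B" for a X
    using MI assms that by (intro marginal_eq_subset[of \<Omega> f "{a}" B X]) (auto simp: MI_def)
  moreover have "marginal f {b} X = f {b}" if "b \<in> B" "X \<subseteq> A" for b X
    using MI assms that by (intro marginal_eq_subset[of \<Omega> f "{b}" A X]) (auto simp: MI_def)
  ultimately show "SMI f A B"
    by (simp add: SMI_def)
qed (simp add: MI_def SMI_def)

lemma SMI_imp_PI: "SMI f A B \<Longrightarrow> PI f A B"
  by (simp add: SMI_def PI_def)

lemma ModI_imp_SModI: "ModI f A B \<Longrightarrow> SModI f A B"
  unfolding ModI_def SModI_def by blast

text \<open>The instances \<open>X = B\<close> and \<open>X = A\<close>; disjointness keeps the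
  added element outside \<open>X\<close>.\<close>

lemma SModI_imp_MI: "A \<inter> B = {} \<Longrightarrow> SModI f A B \<Longrightarrow> MI f A B"
  unfolding SModI_def MI_def by blast

text \<open>Build \<open>X\<close> one element at a time: under \<open>ModI\<close> each new element
  adds its own singleton value, whatever has been collected before.\<close>

lemma ModI_sum_singletons:
  assumes "normalized f" "ModI f A B" "finite X" "X \<subseteq> A \<union> B"
  shows "f X = (\<Sum>x\<in>X. f {x})"
  using assms(3,4)
proof induction
  case empty
  then show ?case
    using assms(1) by (simp add: normalized_def)
next
  case (insert x X)
  then have "marginal f {x} X = f {x}"
    using assms(2) by (simp add: ModI_def)
  with insert show ?case
    by (simp add: marginal_def)
qed

text \<open>The sum over the disjoint union \<open>A \<union> B\<close> splits into the sums over
  \<open>A\<close> and \<open>B\<close>, so the mutual information cancels.\<close>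

lemma ModI_imp_JI:
  assumes "normalized f" "finite A" "finite B" "A \<inter> B = {}" "ModI f A B"
  shows "JI f A B"
  using ModI_sum_singletons[OF assms(1,5), of A] ModI_sum_singletons[OF assms(1,5), of B]
    ModI_sum_singletons[OF assms(1,5), of "A \<union> B"] sum.union_disjoint[OF assms(2-4), of "\<lambda>x. f {x}"] assms(2,3)
  unfolding JI_def mutual_info_def by (metis Un_upper1 Un_upper2 finite_UnI order_refl diff_self)

text \<open>The rank function of the matroid in which \<open>g\<close> identifies parallel elements, truncated to
  rank \<open>r\<close>.\<close>

definition truncated_rank :: "nat \<Rightarrow> ('a \<Rightarrow> 'b) \<Rightarrow> 'a set \<Rightarrow> real" where
  "truncated_rank r g X = real (min (card (g ` X)) r)"

lemma mono_on_truncated_rank: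
  assumes "finite \<Omega>"
  shows "mono_on (Pow \<Omega>) (truncated_rank r g)"
proof (rule mono_onI)
  fix S T assume "S \<in> Pow \<Omega>" "T \<in> Pow \<Omega>" "S \<subseteq> T"
  then have "card (g ` S) \<le> card (g ` T)"
    using assms by (intro card_mono image_mono finite_imageI) (auto intro: finite_subset)
  then show "truncated_rank r g S \<le> truncated_rank r g T"
    by (simp add: truncated_rank_def)
qed

lemma normalized_truncated_rank: "normalized (truncated_rank r g)"
  by (simp add: normalized_def truncated_rank_def)

text \<open>The cardinalities of \<open>g\<close> S\<open>and\<close>g \<open>T\<close> have the
  same sum as those of their union and intersection, and lie between these two. Since
  \<open>min _ r\<close> is concave, truncation turns this equality into the required
  inequality.\<close>

lemma submodular_on_truncated_rank:
  assumes "finite \<Omega>"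
  shows "submodular_on \<Omega> (truncated_rank r g)"
  unfolding submodular_on_def
proof (intro allI impI)
  fix S T assume "S \<subseteq> \<Omega> \<and> T \<subseteq> \<Omega>"
  then have fin: "finite (g ` S)" "finite (g ` T)"
    using assms by (auto intro: finite_subset)
  \<comment> \<open>Only an inequality, as \<open>g\<close> may identify an element of
    \<open>S\<close> with a different one of \<open>T\<close>.\<close>
  have "card (g ` (S \<inter> T)) \<le> card (g ` S \<inter> g ` T)"
    using fin by (intro card_mono) auto
  moreover have "card (g ` S \<inter> g ` T) \<le> card (g ` S)" "card (g ` S \<inter> g ` T) \<le> card (g ` T)"
    using fin by (auto intro: card_mono)
  moreover have "card (g ` S) + card (g ` T) = card (g ` (S \<union> T)) + card (g ` S \<inter> g ` T)"
    using card_Un_Int[OF fin] by (simp add: image_Un)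
  ultimately have "min (card (g ` (S \<union> T))) r + min (card (g ` (S \<inter> T))) r
      \<le> min (card (g ` S)) r + min (card (g ` T)) r"
    by linarith
  then show "truncated_rank r g (S \<union> T) + truncated_rank r g (S \<inter> T)
      \<le> truncated_rank r g S + truncated_rank r g T"
    unfolding truncated_rank_def of_nat_add[symmetric] of_nat_le_iff .
qed

text \<open>Under \<open>n div 2\<close> the elements 0 and 1 are parallel, while 2 is alone in its
  class. The two sides have rank 1 each and together rank 2, but 1 adds nothing to 0 inside the
  first side.\<close>

lemma JI_not_SModI:
  fixes f :: "nat set \<Rightarrow> real"
  defines "f \<equiv> truncated_rank 2 (\<lambda>n. n div 2)"
  shows "JI f {0, 1} {2}" "\<not> SModI f {0, 1} {2}"
proof -
  show "JI f {0, 1} {2}"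
    by (simp add: JI_def mutual_info_def f_def truncated_rank_def)
  have "marginal f {1} {0} \<noteq> f {1}"
    by (simp add: marginal_def f_def truncated_rank_def)
  then show "\<not> SModI f {0, 1} {2}"
    unfolding SModI_def by (auto dest!: spec[of _ "{0}"])
qed

text \<open>The uniform matroid of rank 3 on four elements: all four together have rank 3, less than
  2 + 2.\<close>

lemma SModI_not_JI:
  fixes f :: "nat set \<Rightarrow> real"
  defines "f \<equiv> truncated_rank 3 id"
  shows "SModI f {0, 1} {2, 3}" "\<not> JI f {0, 1} {2, 3}"
proof -
  show "\<not> JI f {0, 1} {2, 3}"
    by (simp add: JI_def mutual_info_def f_def truncated_rank_def)
  show "SModI f {0, 1} {2, 3}"
    unfolding SModI_def
  proof (intro allI impI ballI)
    fix X j assume X: "X \<subseteq> {0, 1} \<or> X \<subseteq> {2, 3::nat}" and j: "j \<in> {0, 1} \<union> {2, 3} - X"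
    \<comment> \<open>Adding \<open>j\<close> then gives at most three elements, which are still
      independent in rank 3.\<close>
    have "finite X" "card X \<le> 2"
      using X card_mono[of "{0, 1}" X] card_mono[of "{2, 3}" X] by (auto intro: finite_subset)
    with j show "marginal f {j} X = f {j}"
      by (simp add: marginal_def f_def truncated_rank_def)
  qed
qed

text \<open>The uniform matroid of rank 2 on three elements: any two are independent, but 2 adds
  nothing to the pair of 0 and 1.\<close>

lemma PI_not_MI:
  fixes f :: "nat set \<Rightarrow> real"
  defines "f \<equiv> truncated_rank 2 id"
  shows "PI f {0, 1} {2}" "\<not> MI f {0, 1} {2}"
  by (simp_all add: PI_def MI_def marginal_def f_def truncated_rank_def)

text \<open>Reduces each counterexample to checking \<open>P\<close> and \<open>Q\<close> on a rank
  function, with \<open>A \<union> B\<close> as ground set.\<close>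

lemma truncated_rank_counterexample:
  assumes "finite A" "finite B" "A \<inter> B = {}"
    and "P (truncated_rank r g) A B" "\<not> Q (truncated_rank r g) A B"
  shows "\<exists>\<Omega> f A B. finite \<Omega> \<and> mono_on (Pow \<Omega>) f \<and> normalized f \<and> submodular_on \<Omega> f \<and>
    A \<subseteq> \<Omega> \<and> B \<subseteq> \<Omega> \<and> A \<inter> B = {} \<and> P f A B \<and> \<not> Q f A B"
  using assms
  by (intro exI[of _ "A \<union> B"] exI[of _ "truncated_rank r g"] exI[of _ A] exI[of _ B])
     (simp add: mono_on_truncated_rank normalized_truncated_rank submodular_on_truncated_rank)

theorem mainTheorem1:
  shows "(\<forall>(\<Omega>::'a set) (f::'a set \<Rightarrow> real) A B.
            finite \<Omega> \<and> mono_on (Pow \<Omega>) f \<and> normalized f \<and> submodular_on \<Omega> f \<and>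
            A \<subseteq> \<Omega> \<and> B \<subseteq> \<Omega> \<and> A \<inter> B = {} \<longrightarrow>
              (ModI f A B \<longrightarrow> JI f A B) \<and>
              (JI f A B \<longrightarrow> MI f A B) \<and>
              (MI f A B \<longleftrightarrow> SMI f A B) \<and>
              (SMI f A B \<longrightarrow> PI f A B) \<and>
              (ModI f A B \<longrightarrow> SModI f A B) \<and>
              (SModI f A B \<longrightarrow> MI f A B))
       \<and> (\<forall>(P, Q) \<in> {(JI, ModI), (SModI, ModI), (JI, SModI), (SModI, JI),
                      (MI, SModI), (MI, JI), (PI, MI)}.
            \<exists>(\<Omega>::nat set) (f::nat set \<Rightarrow> real) A B.
              finite \<Omega> \<and> mono_on (Pow \<Omega>) f \<and> normalized f \<and> submodular_on \<Omega> f \<and>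
              A \<subseteq> \<Omega> \<and> B \<subseteq> \<Omega> \<and> A \<inter> B = {} \<and>
              P f A B \<and> \<not> Q f A B)"
proof (intro conjI, goal_cases)
  case 1
  show ?case
  proof (intro allI impI)
    fix \<Omega> :: "'a set" and f :: "'a set \<Rightarrow> real" and A B
    assume H: "finite \<Omega> \<and> mono_on (Pow \<Omega>) f \<and> normalized f \<and> submodular_on \<Omega> f \<and>
      A \<subseteq> \<Omega> \<and> B \<subseteq> \<Omega> \<and> A \<inter> B = {}"
    then have "finite A" "finite B"
      by (auto intro: finite_subset)
    with H show "(ModI f A B \<longrightarrow> JI f A B) \<and> (JI f A B \<longrightarrow> MI f A B) \<and>
        (MI f A B \<longleftrightarrow> SMI f A B) \<and> (SMI f A B \<longrightarrow> PI f A B) \<and>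
        (ModI f A B \<longrightarrow> SModI f A B) \<and> (SModI f A B \<longrightarrow> MI f A B)"
      using ModI_imp_JI[of f A B] JI_imp_MI[of \<Omega> f A B] MI_iff_SMI[of \<Omega> f A B]
        SMI_imp_PI[of f A B] ModI_imp_SModI[of f A B] SModI_imp_MI[of A B f]
      by simp
  qed
next
  case 2
  let ?f = "truncated_rank 2 (\<lambda>n::nat. n div 2)" and ?g = "truncated_rank 3 (id :: nat \<Rightarrow> nat)"
  \<comment> \<open>The positive implications let the same two functions also refute MI
    \<Rightarrow> SModI and MI \<Rightarrow> JI and, by contraposition, JI \<Rightarrow> ModI and
    SModI \<Rightarrow> ModI.\<close>
  have MI1: "MI ?f {0, 1} {2}"
    using JI_not_SModI(1)
    by (intro JI_imp_MI[of "{0, 1, 2}"] submodular_on_truncated_rank normalized_truncated_rank) auto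
  have MI2: "MI ?g {0, 1} {2, 3}"
    using SModI_not_JI(1) by (intro SModI_imp_MI) auto
  have nModI1: "\<not> ModI ?f {0, 1} {2}"
    using JI_not_SModI(2) ModI_imp_SModI by blast
  have nModI2: "\<not> ModI ?g {0, 1} {2, 3}"
    using SModI_not_JI(2) ModI_imp_JI[OF normalized_truncated_rank, of "{0, 1::nat}" "{2, 3}"] by force
  note ex1 = truncated_rank_counterexample[of "{0, 1::nat}" "{2}" _ 2 "\<lambda>n. n div 2"]
    and ex2 = truncated_rank_counterexample[of "{0, 1::nat}" "{2, 3}" _ 3 id]
    and ex3 = truncated_rank_counterexample[of "{0, 1::nat}" "{2}" _ 2 id]
  show ?case
    \<comment> \<open>Quantifying over the explicit set becomes a conjunction of seven claims in the
      listed order, ending in a \<open>True\<close> from the empty set.\<close>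
    unfolding ball_simps prod.case
  proof (intro conjI TrueI, goal_cases)
    case 1 show ?case by (rule ex1) (use JI_not_SModI nModI1 in auto)
  next
    case 2 show ?case by (rule ex2) (use SModI_not_JI nModI2 in auto)
  next
    case 3 show ?case by (rule ex1) (use JI_not_SModI in auto)
  next
    case 4 show ?case by (rule ex2) (use SModI_not_JI in auto)
  next
    case 5 show ?case by (rule ex1) (use JI_not_SModI MI1 in auto)
  next
    case 6 show ?case by (rule ex2) (use SModI_not_JI MI2 in auto)
  next
    case 7 show ?case by (rule ex3) (use PI_not_MI in auto)
  qed
qed

end
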